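(* Let $X$ be a metrizable, separable, locally compact space and let $\mathcal F=\{f_1,\dots,f_m\}$ be an iterated function system on $X$ with compact dynamics, whose global attractor $\mathcal G_{\mathcal F}$ is connected. Then the chain graph $\Gamma_{\mathcal C_{\mathcal F}}$ of $\mathcal F$ is a connected graph.
   Context: Fix any metric $d$ on $X$ compatible with its topology. An iterated function system (IFS) on $X$ is a finite collection $\mathcal F=\{f_1,\dots,f_m\}$, $m\ge1$, of continuous maps $X\to X$. $\mathcal I^m$ is the set of all finite words in the letters $1,\dots,m$ (including the empty word $0$); $|I|$ is the length of $I$. For $I=i_1\cdots i_k$, $\Phi^I_{\mathcal F}=f_{i_k}\circ\dots\circ f_{i_1}$, and $\Phi^0_{\mathcal F}=\mathrm{id}_X$. $H_{\mathcal F}(A)=\bigcup_{i=1}^m f_i(A)$; $A$ is $H$-invariant if $H_{\mathcal F}(A)=A$. $N_\varepsilon(A)=\{x:d(x,A)<\varepsilon\}$. $A$ attracts $K$ if for every $\varepsilon>0$ there is $\tau>0$ with $\Phi^I_{\mathcal F}(K)\subset N_\varepsilon(A)$ for every $|I|\ge\tau$. A global attractor is a compact $H$-invariant set that attracts every compact subset of $X$; it is unique if it exists and is denoted $\mathcal G_{\mathcal F}$. $\mathcal F$ has compact dynamics if it has a global attractor. Chains: an $\varepsilon$-chain from $x$ to $y$ is a finite sequence $x_0=x,x_1,\dots,x_k=y$ ($k\ge0$) in $X$ with indices $i_0,\dots,i_{k-1}$ such that $d(f_{i_n}(x_n),x_{n+1})<\varepsilon$ for $n=0,\dots,k-1$.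 Write $x\succcurlyeq y$ if for every $\varepsilon>0$ there is an $\varepsilon$-chain from $x$ to $y$; $x,y$ are chain-equivalent if $x\succcurlyeq y$ and $y\succcurlyeq x$. A point $x$ is chain-recurrent if it is chain-equivalent to $f_i(x)$ for some $i$. Chain nodes are the chain-equivalence classes of the set of chain-recurrent points. The chain graph $\Gamma_{\mathcal C_{\mathcal F}}$ has the chain nodes as vertices, with a directed edge from $N_1$ to $N_2\ne N_1$ when $x\succcurlyeq y$ for some $x\in N_1,y\in N_2$. Connectedness: a nodes partition is a splitting of the set of all nodes into two non-empty disjoint collections $\mathcal N_1,\mathcal N_2$ such that the unions $N_1=\bigcup_{M\in\mathcal N_1}M$ and $N_2=\bigcup_{M\in\mathcal N_2}M$ are closed (and disjoint) subsets of $X$. The graph is connected if, for every nodes partition $\mathcal N_1,\mathcal N_2$, there is an edge from a node of one collection to a node of the other. *)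

theory Defs
  imports "HOL-Analysis.Analysis"
begin

text \<open>
  The space \<open>X\<close> is a type of class \<^class>\<open>metric_space\<close>; its metric is the fixed compatible metric.
  An IFS \<open>{f\<^sub>1, \<dots>, f\<^sub>m}\<close> is given by \<open>m\<close> and a family \<open>f\<close>, of which only the members with index in
  \<open>{1..m}\<close> are ever used.
\<close>

definition ifs :: "nat \<Rightarrow> (nat \<Rightarrow> 'a::topological_space \<Rightarrow> 'a) \<Rightarrow> bool" where
  "ifs m f \<longleftrightarrow> 1 \<le> m \<and> (\<forall>i\<in>{1..m}. continuous_on UNIV (f i))"

definition words :: "nat \<Rightarrow> nat list set" where
  "words m = lists {1..m}"

text \<open>\<^const>\<open>fold\<close> applies the map of the first letter first.\<close>

definition word_map :: "(nat \<Rightarrow> 'a \<Rightarrow> 'a) \<Rightarrow> nat list \<Rightarrow> 'a \<Rightarrow> 'a" where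
  "word_map f I = fold f I"

definition hutchinson :: "nat \<Rightarrow> (nat \<Rightarrow> 'a \<Rightarrow> 'a) \<Rightarrow> 'a set \<Rightarrow> 'a set" where
  "hutchinson m f A = (\<Union>i\<in>{1..m}. f i ` A)"

text \<open>The guard is needed because \<^term>\<open>infdist x {} = 0\<close>, whereas \<open>d(x, {}) = \<infinity>\<close>.\<close>

definition nbhd :: "real \<Rightarrow> 'a::metric_space set \<Rightarrow> 'a set" where
  "nbhd \<epsilon> A = {x. A \<noteq> {} \<and> infdist x A < \<epsilon>}"

definition attracts :: "nat \<Rightarrow> (nat \<Rightarrow> 'a::metric_space \<Rightarrow> 'a) \<Rightarrow> 'a set \<Rightarrow> 'a set \<Rightarrow> bool" where
  "attracts m f A K \<longleftrightarrow>
     (\<forall>\<epsilon>>0. \<exists>\<tau>>0. \<forall>I\<in>words m. \<tau> \<le> length I \<longrightarrow> word_map f I ` K \<subseteq> nbhd \<epsilon> A)"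

definition is_global_attractor :: "nat \<Rightarrow> (nat \<Rightarrow> 'a::metric_space \<Rightarrow> 'a) \<Rightarrow> 'a set \<Rightarrow> bool" where
  "is_global_attractor m f G \<longleftrightarrow>
     compact G \<and> hutchinson m f G = G \<and> (\<forall>K. compact K \<longrightarrow> attracts m f G K)"

definition compact_dynamics :: "nat \<Rightarrow> (nat \<Rightarrow> 'a::metric_space \<Rightarrow> 'a) \<Rightarrow> bool" where
  "compact_dynamics m f \<longleftrightarrow> (\<exists>G. is_global_attractor m f G)"

definition global_attractor :: "nat \<Rightarrow> (nat \<Rightarrow> 'a::metric_space \<Rightarrow> 'a) \<Rightarrow> 'a set" where
  "global_attractor m f = (THE G. is_global_attractor m f G)"

lemma hutchinson_invariant_word:
  assumes "hutchinson m f G = G" "x \<in> G"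
  shows "\<exists>I\<in>words m. length I = n \<and> x \<in> word_map f I ` G"
  using assms(2)
proof (induction n arbitrary: x)
  case 0
  then show ?case by (intro bexI[of _ "[]"]) (auto simp: words_def word_map_def)
next
  case (Suc n)
  then obtain i y where i: "i \<in> {1..m}" "y \<in> G" "x = f i y"
    using assms(1) unfolding hutchinson_def by blast
  from Suc.IH[OF i(2)] obtain I where I: "I \<in> words m" "length I = n" "y \<in> word_map f I ` G"
    by blast
  then show ?case using i
    by (intro bexI[of _ "I @ [i]"]) (auto simp: words_def word_map_def)
qed

lemma global_attractor_subset:
  assumes "is_global_attractor m f G" "is_global_attractor m f G'"
  shows "G \<subseteq> G'"
proof
  fix x assume x: "x \<in> G"
  have near: "x \<in> nbhd \<epsilon> G'" if "0 < \<epsilon>" for \<epsilon>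
  proof -
    have "attracts m f G' G"
      using assms unfolding is_global_attractor_def by blast
    then obtain \<tau> where "\<forall>I\<in>words m. \<tau> \<le> length I \<longrightarrow> word_map f I ` G \<subseteq> nbhd \<epsilon> G'"
      using \<open>0 < \<epsilon>\<close> unfolding attracts_def by meson
    moreover obtain I where "I \<in> words m" "length I = \<tau>" "x \<in> word_map f I ` G"
      using hutchinson_invariant_word x assms(1) unfolding is_global_attractor_def by metis
    ultimately show ?thesis by blast
  qed
  then have "G' \<noteq> {}" using near[of 1] by (auto simp: nbhd_def)
  moreover have "infdist x G' = 0"
    using near infdist_nonneg[of x G'] unfolding nbhd_def
    by (metis (mono_tags, lifting) mem_Collect_eq less_irrefl order_le_less)
  moreover have "closed G'"
    using assms(2) compact_imp_closed unfolding is_global_attractor_def by blast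
  ultimately show "x \<in> G'" by (simp add: in_closed_iff_infdist_zero)
qed

lemma global_attractor_eq:
  assumes "is_global_attractor m f G"
  shows "global_attractor m f = G"
  unfolding global_attractor_def
  by (rule the_equality) (use assms global_attractor_subset in \<open>blast+\<close>)

definition eps_chain ::
  "nat \<Rightarrow> (nat \<Rightarrow> 'a::metric_space \<Rightarrow> 'a) \<Rightarrow> real \<Rightarrow> 'a \<Rightarrow> 'a \<Rightarrow> bool" where
  "eps_chain m f \<epsilon> x y \<longleftrightarrow>
     (\<exists>k p i. p 0 = x \<and> p k = y \<and>
        (\<forall>n<k. i n \<in> {1..m} \<and> dist (f (i n) (p n)) (p (Suc n)) < \<epsilon>))"

definition chain_ge :: "nat \<Rightarrow> (nat \<Rightarrow> 'a::metric_space \<Rightarrow> 'a) \<Rightarrow> 'a \<Rightarrow> 'a \<Rightarrow> bool" where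
  "chain_ge m f x y \<longleftrightarrow> (\<forall>\<epsilon>>0. eps_chain m f \<epsilon> x y)"

definition chain_equiv :: "nat \<Rightarrow> (nat \<Rightarrow> 'a::metric_space \<Rightarrow> 'a) \<Rightarrow> 'a \<Rightarrow> 'a \<Rightarrow> bool" where
  "chain_equiv m f x y \<longleftrightarrow> chain_ge m f x y \<and> chain_ge m f y x"

definition chain_recurrent :: "nat \<Rightarrow> (nat \<Rightarrow> 'a::metric_space \<Rightarrow> 'a) \<Rightarrow> 'a set" where
  "chain_recurrent m f = {x. \<exists>i\<in>{1..m}. chain_equiv m f x (f i x)}"

definition chain_nodes :: "nat \<Rightarrow> (nat \<Rightarrow> 'a::metric_space \<Rightarrow> 'a) \<Rightarrow> 'a set set" where
  "chain_nodes m f = chain_recurrent m f //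
     {(x, y). x \<in> chain_recurrent m f \<and> y \<in> chain_recurrent m f \<and> chain_equiv m f x y}"

definition chain_edges :: "nat \<Rightarrow> (nat \<Rightarrow> 'a::metric_space \<Rightarrow> 'a) \<Rightarrow> ('a set \<times> 'a set) set" where
  "chain_edges m f = {(M, N). M \<in> chain_nodes m f \<and> N \<in> chain_nodes m f \<and> N \<noteq> M \<and>
     (\<exists>x\<in>M. \<exists>y\<in>N. chain_ge m f x y)}"

text \<open>A directed graph is a pair of its vertex set and its edge set; the vertices are subsets of \<open>X\<close>.\<close>

definition chain_graph ::
  "nat \<Rightarrow> (nat \<Rightarrow> 'a::metric_space \<Rightarrow> 'a) \<Rightarrow> 'a set set \<times> ('a set \<times> 'a set) set" where
  "chain_graph m f = (chain_nodes m f, chain_edges m f)"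

definition nodes_partition ::
  "'a::topological_space set set \<Rightarrow> 'a set set \<Rightarrow> 'a set set \<Rightarrow> bool" where
  "nodes_partition V \<N>1 \<N>2 \<longleftrightarrow>
     \<N>1 \<union> \<N>2 = V \<and> \<N>1 \<inter> \<N>2 = {} \<and> \<N>1 \<noteq> {} \<and> \<N>2 \<noteq> {} \<and>
     closed (\<Union>\<N>1) \<and> closed (\<Union>\<N>2) \<and> \<Union>\<N>1 \<inter> \<Union>\<N>2 = {}"

text \<open>The connecting edge may go in either direction.\<close>

definition connected_graph ::
  "'a::topological_space set set \<times> ('a set \<times> 'a set) set \<Rightarrow> bool" where
  "connected_graph \<Gamma> \<longleftrightarrow>
     (\<forall>\<N>1 \<N>2. nodes_partition (fst \<Gamma>) \<N>1 \<N>2 \<longrightarrow>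
        (\<exists>M\<in>\<N>1. \<exists>N\<in>\<N>2. (M, N) \<in> snd \<Gamma> \<or> (N, M) \<in> snd \<Gamma>))"

end

theory Submission
  imports Defs
begin

text \<open>
  Every point has a chain-recurrent point of the attractor \<open>G\<close> downstream (a limit point of its
  forward orbit under a single map), and every point of \<open>G\<close> has one upstream (a limit point of a
  backward orbit in \<open>G\<close>). If a nodes partition had no edge between its two parts, then no point of
  \<open>G\<close> could have both parts downstream, since its upstream node would be joined to both. As the
  chain relation is closed, the points of \<open>G\<close> lying above the two parts would then split \<open>G\<close> into
  two disjoint non-empty closed sets.
\<close>

section \<open>Chains as paths of a one-step relation\<close>

definition eps_step :: "nat \<Rightarrow> (nat \<Rightarrow> 'a::metric_space \<Rightarrow> 'a) \<Rightarrow> real \<Rightarrow> 'a \<Rightarrow> 'a \<Rightarrow> bool" where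
  "eps_step m f \<epsilon> x y \<longleftrightarrow> (\<exists>i\<in>{1..m}. dist (f i x) y < \<epsilon>)"

text \<open>Serves to replace indexed sequences by closures of a relation: concatenating chains
  becomes transitivity, and chains with at least one step become the transitive closure.\<close>

lemma eps_chain_iff_rtranclp: "eps_chain m f \<epsilon> x y \<longleftrightarrow> (eps_step m f \<epsilon>)\<^sup>*\<^sup>* x y"
proof -
  have "eps_chain m f \<epsilon> x y \<longleftrightarrow>
      (\<exists>k p. p 0 = x \<and> p k = y \<and> (\<forall>n<k. eps_step m f \<epsilon> (p n) (p (Suc n))))"
    unfolding eps_chain_def eps_step_def Bex_def by metis
  then show ?thesis
    unfolding rtranclp_power relpowp_fun_conv .
qed

lemma eps_step_mono: "eps_step m f \<delta> x y \<Longrightarrow> \<delta> \<le> \<epsilon> \<Longrightarrow> eps_step m f \<epsilon> x y"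
  unfolding eps_step_def by force

lemma chain_ge_refl: "chain_ge m f x x"
  by (simp add: chain_ge_def eps_chain_iff_rtranclp)

lemma chain_ge_trans: "chain_ge m f x y \<Longrightarrow> chain_ge m f y z \<Longrightarrow> chain_ge m f x z"
  unfolding chain_ge_def eps_chain_iff_rtranclp by (meson rtranclp_trans)

lemma chain_ge_map: "i \<in> {1..m} \<Longrightarrow> chain_ge m f x (f i x)"
  unfolding chain_ge_def eps_chain_iff_rtranclp
  by (force simp: eps_step_def intro: r_into_rtranclp)

lemma chain_ge_mono_seq:
  assumes "\<And>n. chain_ge m f (p n) (p (Suc n))" and "k \<le> l"
  shows "chain_ge m f (p k) (p l)"
  using assms(2)
proof (induction rule: dec_induct)
  case base
  show ?case by (rule chain_ge_refl)
next
  case (step n)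
  show ?case by (rule chain_ge_trans[OF step.IH assms(1)])
qed

lemma chain_ge_antimono_seq:
  assumes "\<And>n. chain_ge m f (p (Suc n)) (p n)" and "k \<le> l"
  shows "chain_ge m f (p l) (p k)"
  using assms(2)
proof (induction rule: dec_induct)
  case base
  show ?case by (rule chain_ge_refl)
next
  case (step n)
  show ?case by (rule chain_ge_trans[OF assms(1) step.IH])
qed

section \<open>Closedness of the chain relation\<close>

lemma tranclp_eps_step_perturb_end:
  assumes "(eps_step m f \<delta>)\<^sup>+\<^sup>+ x y" and "dist y y' < \<delta>"
  shows "(eps_step m f (2 * \<delta>))\<^sup>+\<^sup>+ x y'"
proof -
  have "0 \<le> \<delta>" using assms(2) zero_le_dist[of y y'] by linarith
  \<comment> \<open>The chain is cut before its last step, whose jump absorbs the move from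
    \<open>y\<close> to \<open>y'\<close>. An empty chain would have no jump to do so, hence the
    transitive closure.\<close>
  obtain u where u: "(eps_step m f \<delta>)\<^sup>*\<^sup>* x u" "eps_step m f \<delta> u y"
    using assms(1) by (metis tranclp.cases rtranclp.rtrancl_refl tranclp_into_rtranclp)
  have "(eps_step m f (2 * \<delta>))\<^sup>*\<^sup>* x u"
    using u(1) by (rule mono_rtranclp[rule_format, rotated]) (use eps_step_mono \<open>0 \<le> \<delta>\<close> in fastforce)
  moreover obtain i where "i \<in> {1..m}" "dist (f i u) y < \<delta>"
    using u(2) unfolding eps_step_def by blast
  then have "eps_step m f (2 * \<delta>) u y'"
    using assms(2) dist_triangle_lt[of "f i u" y y'] dist_triangle[of "f i u" y' y]
    unfolding eps_step_def by (intro bexI[of _ i]) auto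
  ultimately show ?thesis by (rule rtranclp_into_tranclp1)
qed

text \<open>Only the first jump changes. The bound is on the images of the two starting points, so
  continuity at the limit point suffices when one of them tends to the other.\<close>

lemma tranclp_eps_step_perturb_start:
  assumes "(eps_step m f \<delta>)\<^sup>+\<^sup>+ x y" and "\<And>i. i \<in> {1..m} \<Longrightarrow> dist (f i x') (f i x) < \<delta>"
  shows "(eps_step m f (2 * \<delta>))\<^sup>+\<^sup>+ x' y"
proof -
  obtain u where u: "eps_step m f \<delta> x u" "(eps_step m f \<delta>)\<^sup>*\<^sup>* u y"
    using assms(1) by (blast dest: tranclpD)
  then obtain i where i: "i \<in> {1..m}" "dist (f i x) u < \<delta>"
    unfolding eps_step_def by blast
  then have "0 \<le> \<delta>" using zero_le_dist[of "f i x" u] by linarith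
  have "(eps_step m f (2 * \<delta>))\<^sup>*\<^sup>* u y"
    using u(2) by (rule mono_rtranclp[rule_format, rotated]) (use eps_step_mono \<open>0 \<le> \<delta>\<close> in fastforce)
  moreover have "eps_step m f (2 * \<delta>) x' u"
    using i assms(2)[OF i(1)] dist_triangle[of "f i x'" u "f i x"]
    unfolding eps_step_def by (intro bexI[of _ i]) auto
  ultimately show ?thesis by (rule rtranclp_into_tranclp2[rotated])
qed

lemma ifs_tendsto:
  assumes "ifs m f" "i \<in> {1..m}" "(X \<longlongrightarrow> x) F"
  shows "((\<lambda>n. f i (X n)) \<longlongrightarrow> f i x) F"
  using assms continuous_on_tendsto_compose[of UNIV "f i" X x F] unfolding ifs_def by auto

text \<open>For large \<open>n\<close>, both ends of a chain from \<open>X n\<close> to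
  \<open>Y n\<close> can be moved to \<open>x\<close> and \<open>y\<close>. This needs a chain with
  at least one step, which \<open>X n \<noteq> Y n\<close> guarantees; for \<open>x = y\<close> the
  empty chain does.\<close>

lemma chain_ge_limit:
  assumes "ifs m f" and "X \<longlonglongrightarrow> x" "Y \<longlonglongrightarrow> y"
    and "\<forall>\<^sub>F n in sequentially. chain_ge m f (X n) (Y n)"
  shows "chain_ge m f x y"
proof (cases "x = y")
  case False
  show ?thesis
    unfolding chain_ge_def eps_chain_iff_rtranclp
  proof (intro allI impI)
    fix \<epsilon> :: real assume "0 < \<epsilon>"
    \<comment> \<open>Moving each of the two ends doubles the admissible jump.\<close>
    define \<delta> where "\<delta> = \<epsilon> / 4"
    have "0 < \<delta>" using \<open>0 < \<epsilon>\<close> by (simp add: \<delta>_def)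
    have "(\<lambda>n. dist (X n) (Y n)) \<longlonglongrightarrow> dist x y"
      by (intro tendsto_dist assms)
    then have "\<forall>\<^sub>F n in sequentially. 0 < dist (X n) (Y n)"
      using False by (intro order_tendstoD(1)) auto
    moreover have "\<forall>\<^sub>F n in sequentially. \<forall>i\<in>{1..m}. dist (f i (X n)) (f i x) < \<delta>"
      using tendstoD[OF ifs_tendsto[OF assms(1) _ assms(2)] \<open>0 < \<delta>\<close>]
      by (intro eventually_ball_finite) auto
    moreover have "\<forall>\<^sub>F n in sequentially. dist (Y n) y < \<delta>"
      using \<open>0 < \<delta>\<close> assms(3) by (intro tendstoD)
    ultimately have "\<forall>\<^sub>F n in sequentially. chain_ge m f (X n) (Y n) \<and> X n \<noteq> Y n \<and>
        (\<forall>i\<in>{1..m}. dist (f i (X n)) (f i x) < \<delta>) \<and> dist (Y n) y < \<delta>"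
      using assms(4) by eventually_elim auto
    then obtain n where n: "chain_ge m f (X n) (Y n)" "X n \<noteq> Y n"
        "\<forall>i\<in>{1..m}. dist (f i (X n)) (f i x) < \<delta>" "dist (Y n) y < \<delta>"
      using eventually_happens'[OF sequentially_bot] by blast
    have "(eps_step m f \<delta>)\<^sup>+\<^sup>+ (X n) (Y n)"
      using n(1,2) \<open>0 < \<delta>\<close> unfolding chain_ge_def eps_chain_iff_rtranclp by (metis rtranclpD)
    then have "(eps_step m f (2 * \<delta>))\<^sup>+\<^sup>+ (X n) y"
      using n(4) by (rule tranclp_eps_step_perturb_end)
    then have "(eps_step m f (2 * (2 * \<delta>)))\<^sup>+\<^sup>+ x y"
      by (rule tranclp_eps_step_perturb_start) (use n(3) \<open>0 < \<delta>\<close> in \<open>force simp: dist_commute\<close>)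
    then show "(eps_step m f \<epsilon>)\<^sup>*\<^sup>* x y"
      by (simp add: \<delta>_def tranclp_into_rtranclp)
  qed
qed (simp add: chain_ge_refl)

text \<open>Compactness of \<open>K\<close> makes the targets converge along a subsequence, to which
  \<open>chain_ge_limit\<close> applies.\<close>

lemma closed_chain_ge_compact:
  assumes "ifs m f" "closed G" "compact K"
  shows "closed {x\<in>G. \<exists>z\<in>K. chain_ge m f x z}"
  unfolding closed_sequential_limits
proof (intro allI impI, elim conjE)
  fix X x assume X: "\<forall>n. X n \<in> {x\<in>G. \<exists>z\<in>K. chain_ge m f x z}" "X \<longlonglongrightarrow> x"
  then have "\<forall>n. \<exists>z\<in>K. chain_ge m f (X n) z"
    by blast
  then obtain Z where Z: "\<And>n. Z n \<in> K" "\<And>n. chain_ge m f (X n) (Z n)"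
    by metis
  then obtain z r where "z \<in> K" and r: "strict_mono (r :: nat \<Rightarrow> nat)" "(Z \<circ> r) \<longlonglongrightarrow> z"
    using seq_compactE[OF compact_imp_seq_compact[OF assms(3)], of Z] by blast
  have "chain_ge m f x z"
    using assms(1) LIMSEQ_subseq_LIMSEQ[OF X(2) r(1)] r(2)
    by (rule chain_ge_limit) (simp add: Z)
  moreover have "x \<in> G"
    using assms(2) X unfolding closed_sequential_limits by blast
  ultimately show "x \<in> {x\<in>G. \<exists>z\<in>K. chain_ge m f x z}"
    using \<open>z \<in> K\<close> by blast
qed

section \<open>Chain-recurrent points downstream and upstream\<close>

lemma chain_recurrentI:
  assumes "i \<in> {1..m}" "chain_ge m f (f i x) x"
  shows "x \<in> chain_recurrent m f"
  using assms chain_ge_map[OF assms(1)] unfolding chain_recurrent_def chain_equiv_def by blast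

text \<open>Nearest points in \<open>G\<close> have a convergent subsequence, and \<open>x\<close>
  follows them to the same limit. It is meant for orbits that approach \<open>G\<close> without
  lying in it.\<close>

lemma infdist_compact_LIMSEQ_subseq:
  fixes x :: "nat \<Rightarrow> 'a::metric_space"
  assumes "compact G" "G \<noteq> {}" and "(\<lambda>n. infdist (x n) G) \<longlonglongrightarrow> 0"
  obtains z r where "z \<in> G" "strict_mono (r :: nat \<Rightarrow> nat)" "(x \<circ> r) \<longlonglongrightarrow> z"
proof -
  have "\<exists>g\<in>G. dist (x n) g \<le> infdist (x n) G" for n
  proof -
    obtain g where "g \<in> G" "\<forall>h\<in>G. dist (x n) g \<le> dist (x n) h"
      using continuous_attains_inf[OF assms(1,2) continuous_on_dist[OF continuous_on_const continuous_on_id]]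
      by blast
    then show ?thesis
      using assms(2) by (auto simp: infdist_notempty intro!: bexI[of _ g] cINF_greatest)
  qed
  then obtain g where g: "\<And>n. g n \<in> G" "\<And>n. dist (x n) (g n) \<le> infdist (x n) G"
    by metis
  then obtain z r where "z \<in> G" and r: "strict_mono (r :: nat \<Rightarrow> nat)" "(g \<circ> r) \<longlonglongrightarrow> z"
    using seq_compactE[OF compact_imp_seq_compact[OF assms(1)], of g] by blast
  have "(\<lambda>n. infdist (x (r n)) G) \<longlonglongrightarrow> 0"
    using LIMSEQ_subseq_LIMSEQ[OF assms(3) r(1)] by (simp add: o_def)
  moreover have "(\<lambda>n. dist (g (r n)) z) \<longlonglongrightarrow> 0"
    using tendsto_dist[OF r(2) tendsto_const[of z]] by (simp add: o_def)
  ultimately have bound: "(\<lambda>n. infdist (x (r n)) G + dist (g (r n)) z) \<longlonglongrightarrow> 0"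
    by (rule tendsto_add_zero)
  have le: "dist (x (r n)) z \<le> infdist (x (r n)) G + dist (g (r n)) z" for n
    using dist_triangle[of "x (r n)" z "g (r n)"] g(2)[of "r n"] by linarith
  have "(\<lambda>n. dist (x (r n)) z) \<longlonglongrightarrow> 0"
    by (rule tendsto_sandwich[OF _ _ tendsto_const bound]) (simp_all add: le)
  then have "(x \<circ> r) \<longlonglongrightarrow> z"
    by (subst tendsto_dist_iff) (simp add: o_def)
  then show ?thesis using that \<open>z \<in> G\<close> r(1) by blast
qed

text \<open>Attraction of the compact set \<open>{x}\<close> makes the orbit under
  \<open>f 1\<close> accumulate at a point of \<open>G\<close>; the letter 1 exists because
  \<open>m \<ge> 1\<close>.\<close>

lemma chain_recurrent_downstream:
  assumes "ifs m f" "is_global_attractor m f G"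
  shows "\<exists>z\<in>G \<inter> chain_recurrent m f. chain_ge m f x z"
proof -
  define p where "p n = (f 1 ^^ n) x" for n
  have "1 \<in> {1..m}" using assms(1) unfolding ifs_def by simp
  then have step: "chain_ge m f (p n) (p (Suc n))" for n
    using chain_ge_map[of 1 m f "p n"] by (simp add: p_def)
  have near: "\<exists>N. \<forall>n\<ge>N. p n \<in> nbhd \<epsilon> G" if pos: "0 < \<epsilon>" for \<epsilon>
  proof -
    have "attracts m f G {x}"
      using assms(2) unfolding is_global_attractor_def by simp
    then obtain N where N: "\<forall>I\<in>words m. N \<le> length I \<longrightarrow> word_map f I ` {x} \<subseteq> nbhd \<epsilon> G"
      using pos unfolding attracts_def by meson
    have "fold f (replicate n 1) y = (f 1 ^^ n) y" for n y
      by (induction n arbitrary: y) (simp_all add: funpow_swap1)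
    then have "p n \<in> nbhd \<epsilon> G" if "N \<le> n" for n
      using bspec[OF N, of "replicate n 1"] that \<open>1 \<in> {1..m}\<close>
      by (auto simp: words_def word_map_def p_def in_lists_conv_set)
    then show ?thesis by blast
  qed
  then have "(\<lambda>n. infdist (p n) G) \<longlonglongrightarrow> 0"
    unfolding lim_sequentially nbhd_def by (fastforce simp: infdist_nonneg)
  \<comment> \<open>The guard in \<open>nbhd\<close> makes every neighbourhood of the empty set
    empty.\<close>
  moreover have "G \<noteq> {}" using near[of 1] by (auto simp: nbhd_def)
  moreover have "compact G" using assms(2) by (simp add: is_global_attractor_def)
  ultimately obtain z r where "z \<in> G" and r: "strict_mono (r :: nat \<Rightarrow> nat)" "(p \<circ> r) \<longlonglongrightarrow> z"
    using infdist_compact_LIMSEQ_subseq by metis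
  have "chain_ge m f x z"
    using assms(1) tendsto_const[of x] r(2)
    by (rule chain_ge_limit)
       (use chain_ge_mono_seq[of m f p 0, OF step] in \<open>simp add: p_def\<close>)
  \<comment> \<open>As \<open>Suc (r n) \<le> r (Suc n)\<close>, the orbit leads from
    \<open>f 1 (p (r n))\<close>, which tends to \<open>f 1 z\<close>, to
    \<open>p (r (Suc n))\<close>, which tends to \<open>z\<close>.\<close>
  moreover have "chain_ge m f (f 1 z) z"
  proof (rule chain_ge_limit[OF assms(1) ifs_tendsto[OF assms(1) \<open>1 \<in> {1..m}\<close> r(2)] LIMSEQ_Suc[OF r(2)]],
      rule always_eventually, rule allI)
    fix n
    have "chain_ge m f (p (Suc (r n))) (p (r (Suc n)))"
      by (rule chain_ge_mono_seq[of m f p, OF step]) (simp add: r(1) strict_monoD Suc_leI)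
    then show "chain_ge m f (f 1 ((p \<circ> r) n)) ((p \<circ> r) (Suc n))"
      by (simp add: p_def)
  qed
  ultimately show ?thesis
    using \<open>z \<in> G\<close> chain_recurrentI \<open>1 \<in> {1..m}\<close> by blast
qed

text \<open>Invariance lets \<open>x\<close> be pulled back inside \<open>G\<close> indefinitely,
  but with varying letters. Recurrence asks for a single letter, so the letter too is fixed by
  passing to a subsequence.\<close>

lemma chain_recurrent_upstream:
  assumes "ifs m f" "compact G" "hutchinson m f G = G" "x \<in> G"
  shows "\<exists>w\<in>chain_recurrent m f. chain_ge m f w x"
proof -
  have "\<exists>b. \<forall>n. (b n \<in> G \<and> (n = 0 \<longrightarrow> b n = x)) \<and> (\<exists>i\<in>{1..m}. f i (b (Suc n)) = b n)"
  proof (rule dependent_nat_choice)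
    show "\<exists>y. y \<in> G \<and> (0 = (0::nat) \<longrightarrow> y = x)"
      using assms(4) by blast
    fix y and n :: nat assume "y \<in> G \<and> (n = 0 \<longrightarrow> y = x)"
    then have "y \<in> hutchinson m f G" using assms(3) by simp
    then obtain i y' where "i \<in> {1..m}" "y' \<in> G" "y = f i y'"
      unfolding hutchinson_def by blast
    then show "\<exists>y'. (y' \<in> G \<and> (Suc n = 0 \<longrightarrow> y' = x)) \<and> (\<exists>i\<in>{1..m}. f i y' = y)"
      by blast
  qed
  then obtain b where b: "\<And>n. b n \<in> G" "b 0 = x" "\<And>n. \<exists>i\<in>{1..m}. f i (b (Suc n)) = b n"
    by blast
  then obtain j where j: "\<And>n. j n \<in> {1..m}" "\<And>n. f (j n) (b (Suc n)) = b n"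
    by metis
  have step: "chain_ge m f (b (Suc n)) (b n)" for n
    using chain_ge_map[OF j(1)] j(2) by metis
  \<comment> \<open>Pairing each point with its letter makes both converge along one subsequence;
    since the letters are discrete, they are then eventually constant.\<close>
  have "compact ({1..m} \<times> G)"
    by (intro compact_Times finite_imp_compact assms(2)) simp
  moreover have "\<forall>n. (j n, b (Suc n)) \<in> {1..m} \<times> G"
    using b j by blast
  ultimately obtain l r where l: "l \<in> {1..m} \<times> G" and r: "strict_mono (r :: nat \<Rightarrow> nat)"
      "((\<lambda>n. (j n, b (Suc n))) \<circ> r) \<longlonglongrightarrow> l"
    using seq_compactE[OF compact_imp_seq_compact, of "{1..m} \<times> G" "\<lambda>n. (j n, b (Suc n))"] by blast
  obtain i w where iw: "l = (i, w)" by fastforce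
  have "(\<lambda>n. j (r n)) \<longlonglongrightarrow> i" and lim: "(\<lambda>n. b (Suc (r n))) \<longlonglongrightarrow> w"
    using tendsto_fst[OF r(2)] tendsto_snd[OF r(2)] by (simp_all add: o_def iw)
  then have const: "\<forall>\<^sub>F n in sequentially. j (r n) = i"
    using topological_tendstoD[of "\<lambda>n. j (r n)" i sequentially "{i}"] by (simp add: open_discrete)
  have "i \<in> {1..m}" using l iw by simp
  have "chain_ge m f w x"
    using assms(1) lim tendsto_const[of x]
    by (rule chain_ge_limit)
       (use chain_ge_antimono_seq[of m f b 0, OF step] in \<open>simp add: b(2)\<close>)
  moreover have "chain_ge m f (f i w) w"
  \<comment> \<open>Larger indices of \<open>b\<close> come first in time. The source is shifted to
    \<open>r (Suc n)\<close>, where \<open>f i\<close> leads to \<open>b (r (Suc n))\<close>; from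
    there the orbit runs to \<open>b (Suc (r n))\<close>.\<close>
  proof (rule chain_ge_limit[OF assms(1) LIMSEQ_Suc[OF ifs_tendsto[OF assms(1) \<open>i \<in> {1..m}\<close> lim]] lim])
    have "\<forall>\<^sub>F n in sequentially. j (r (Suc n)) = i"
      using const by (simp add: eventually_sequentially_Suc[of "\<lambda>n. j (r n) = i"])
    then show "\<forall>\<^sub>F n in sequentially. chain_ge m f (f i (b (Suc (r (Suc n))))) (b (Suc (r n)))"
    proof eventually_elim
      case (elim n)
      have "chain_ge m f (b (r (Suc n))) (b (Suc (r n)))"
        by (rule chain_ge_antimono_seq[of m f b, OF step]) (simp add: r(1) strict_monoD Suc_leI)
      then show ?case using j(2) elim by metis
    qed
  qed
  ultimately show ?thesis
    using chain_recurrentI \<open>i \<in> {1..m}\<close> by blast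
qed

section \<open>Chain nodes and the splitting of the attractor\<close>

lemma Union_chain_nodes: "\<Union>(chain_nodes m f) = chain_recurrent m f"
  unfolding chain_nodes_def
  by (intro Union_quotient equivI refl_onI symI transI)
     (auto simp: chain_equiv_def intro: chain_ge_refl chain_ge_trans)

theorem theorem5:
  fixes m :: nat and f :: "nat \<Rightarrow> 'a::metric_space \<Rightarrow> 'a"
  assumes "separable_space (euclidean :: 'a topology)"
    and "locally_compact_space (euclidean :: 'a topology)"
    and "ifs m f"
    and "compact_dynamics m f"
    and "connected (global_attractor m f)"
  shows "connected_graph (chain_graph m f)"
proof -
  define G where "G = global_attractor m f"
  have attr: "is_global_attractor m f G"
    using assms(4) global_attractor_eq unfolding compact_dynamics_def G_def by metis
  then have G: "compact G" "hutchinson m f G = G"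
    by (simp_all add: is_global_attractor_def)
  have False
    if P: "nodes_partition (chain_nodes m f) \<N>1 \<N>2"
      and no_edge: "\<forall>M\<in>\<N>1. \<forall>N\<in>\<N>2. (M, N) \<notin> chain_edges m f \<and> (N, M) \<notin> chain_edges m f"
    for \<N>1 \<N>2
  proof -
    have nodes: "chain_nodes m f = \<N>1 \<union> \<N>2" "\<N>1 \<inter> \<N>2 = {}"
      and closed: "closed (\<Union>\<N>1)" "closed (\<Union>\<N>2)"
      and nonempty: "\<N>1 \<noteq> {}" "\<N>2 \<noteq> {}"
      using P unfolding nodes_partition_def by auto
    have R: "chain_recurrent m f = \<Union>\<N>1 \<union> \<Union>\<N>2"
      using Union_chain_nodes[of m f] nodes by auto
    \<comment> \<open>The two nodes differ because the collections are disjoint, so any chain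
      relation between their points would be an edge.\<close>
    have sep: "\<not> chain_ge m f x y \<and> \<not> chain_ge m f y x" if "x \<in> \<Union>\<N>1" "y \<in> \<Union>\<N>2" for x y
      using that no_edge nodes unfolding chain_edges_def by blast
    \<comment> \<open>Targets are restricted to \<open>G\<close> so that they range over a compact
      set. Nothing is lost, since downstream recurrent points can be found in
      \<open>G\<close>.\<close>
    define S where "S \<N> = {x\<in>G. \<exists>z\<in>G \<inter> \<Union>\<N>. chain_ge m f x z}" for \<N> :: "'a set set"
    have "closed (S \<N>1)" "closed (S \<N>2)"
      unfolding S_def
      by (intro closed_chain_ge_compact assms(3) compact_imp_closed compact_Int_closed G closed)+
    moreover have "G \<subseteq> S \<N>1 \<union> S \<N>2"
      using chain_recurrent_downstream[OF assms(3) attr] unfolding S_def R by blast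
    moreover have "S \<N>1 \<inter> S \<N>2 \<inter> G = {}"
    proof -
      have False if "x \<in> S \<N>1" "x \<in> S \<N>2" for x
      proof -
        have "x \<in> G" using that by (simp add: S_def)
        then obtain w where "w \<in> chain_recurrent m f" "chain_ge m f w x"
          using chain_recurrent_upstream[OF assms(3) G] by blast
        then show False
          using that sep chain_ge_trans unfolding S_def R by blast
      qed
      then show ?thesis by blast
    qed
    moreover have "S \<N>1 \<inter> G \<noteq> {} \<and> S \<N>2 \<inter> G \<noteq> {}"
    proof -
      have "{} \<notin> chain_nodes m f"
        using chain_ge_refl[of m f] unfolding chain_nodes_def quotient_def chain_equiv_def by blast
      then obtain y1 y2 where y: "y1 \<in> \<Union>\<N>1" "y2 \<in> \<Union>\<N>2"
        using nonempty nodes(1) by (metis UnCI Union_iff ex_in_conv)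
      \<comment> \<open>The points \<open>y1\<close> and \<open>y2\<close> may lie outside
        \<open>G\<close>, but by \<open>sep\<close> their downstream recurrent points in
        \<open>G\<close> stay in the same part, and the empty chain puts these into
        \<open>S \<N>1\<close> and \<open>S \<N>2\<close>.\<close>
      show ?thesis
        using chain_recurrent_downstream[OF assms(3) attr, of y1]
          chain_recurrent_downstream[OF assms(3) attr, of y2] y sep chain_ge_refl[of m f]
        unfolding S_def R by blast
    qed
    ultimately show False
      using assms(5) unfolding G_def[symmetric] connected_closed by blast
  qed
  then show ?thesis
    unfolding connected_graph_def chain_graph_def fst_conv snd_conv by blast
qed

end
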